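(* Let $K$ be an algebraically closed field, let $m,n>1$ be integers not divisible by $\mathrm{char}(K)$, and let $A,B,C,D\in K[X]$ be nonzero polynomials such that $\deg(A)-\deg(B)=m$ and $\deg(C)-\deg(D)=n$. Put $F:=A/B$ and $G:=C/D$ in $K(X)$. Then the following are equivalent: (1) the semigroup generated by $F$ and $G$ under composition is not the free semigroup on the letters $F$ and $G$; (2) there is a root of unity $\gamma\in K^*$ for which the semigroup generated by $F$ and $G$ under composition is isomorphic to the semigroup generated by $X^m$ and $\gamma X^n$ under composition, via an isomorphism which maps $F$ and $G$ to $X^m$ and $\gamma X^n$, respectively; (3) there exists an integer $r>0$ for which $F^{\langle r\rangle}\circ G$ and $F^{\langle r\rangle}$ commute under composition; (4) there exist integers $i\ge 0$ and $j>0$ such that, for every integer $r\ge i$ and every integer $s\ge 1$, the functions $F^{\langle r\rangle}\circ G^{\langle s\rangle}$ and $F^{\langle j\rangle}$ commute under composition.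
   Context: For a rational function $F$, $F^{\langle r\rangle}$ denotes the $r$-th iterate of $F$ under composition, with $F^{\langle 0\rangle}=X$. The semigroup generated by $F$ and $G$ under composition consists of all compositions of one or more copies of $F$ and $G$. It "is the free semigroup on the letters $F$ and $G$" if distinct nonempty words in the two letters $F,G$ always give distinct compositions (so it is not free exactly when two distinct words in the letters give the same composition). When $\mathrm{char}(K)=0$, the condition that an integer $>1$ is not divisible by $\mathrm{char}(K)$ is automatically satisfied. *)

theory Defs
  imports "HOL-Computational_Algebra.Computational_Algebra"
begin

type_synonym 'a ratfun = "'a poly fract"

definition ratfun_const :: "'a::field \<Rightarrow> 'a ratfun" where
  "ratfun_const c = to_fract [:c:]"

definition ratfun_X :: "'a::field ratfun" where
  "ratfun_X = to_fract [:0, 1:]"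

definition poly_subst :: "'a::field poly \<Rightarrow> 'a ratfun \<Rightarrow> 'a ratfun" where
  "poly_subst p g = poly (map_poly ratfun_const p) g"

lemma ratfun_const_simps [simp]:
  "ratfun_const 0 = 0" "ratfun_const 1 = 1"
  "ratfun_const (a + b) = ratfun_const a + ratfun_const b"
  "ratfun_const (a * b) = ratfun_const a * ratfun_const b"
  "ratfun_const a = ratfun_const b \<longleftrightarrow> a = b"
  by (simp_all add: ratfun_const_def flip: one_pCons to_fract_add to_fract_mult)

lemma poly_subst_pCons: "poly_subst (pCons c p) g = ratfun_const c + g * poly_subst p g"
  by (simp add: poly_subst_def map_poly_pCons)

lemma poly_subst_0 [simp]: "poly_subst 0 g = 0"
  by (simp add: poly_subst_def)

lemma poly_subst_add: "poly_subst (p + q) g = poly_subst p g + poly_subst q g"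
  by (induction p q rule: poly_induct2) (simp_all add: poly_subst_pCons algebra_simps)

lemma poly_subst_smult: "poly_subst (smult c p) g = ratfun_const c * poly_subst p g"
  by (induction p) (simp_all add: poly_subst_pCons algebra_simps)

lemma poly_subst_mult: "poly_subst (p * q) g = poly_subst p g * poly_subst q g"
  by (induction p)
     (simp_all add: poly_subst_pCons poly_subst_add poly_subst_smult algebra_simps)

lemma poly_subst_X [simp]: "poly_subst p ratfun_X = to_fract p"
  by (induction p)
     (simp_all add: poly_subst_pCons ratfun_const_def ratfun_X_def
        flip: to_fract_add to_fract_mult)

text \<open>
  The composition \<open>f \<circ> g\<close>: write \<open>f = p / q\<close> and substitute \<open>g\<close> into \<open>p\<close> and \<open>q\<close>. By
  \<open>ratfun_comp_Fract\<close> the result does not depend on the fraction, as long as \<open>q(g) \<noteq> 0\<close>.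
  For nonconstant \<open>g\<close> this holds for every \<open>q \<noteq> 0\<close>, because \<open>g\<close> is then transcendental over
  the field. The value is unspecified only if \<open>g\<close> is a constant at which \<open>f\<close> has a pole.
\<close>

definition ratfun_comp :: "'a::field ratfun \<Rightarrow> 'a ratfun \<Rightarrow> 'a ratfun" (infixl "\<circ>\<^sub>R" 75) where
  "f \<circ>\<^sub>R g =
     (THE h. \<exists>p q. f = Fract p q \<and> poly_subst q g \<noteq> 0 \<and> h = poly_subst p g / poly_subst q g)"

lemma ratfun_comp_Fract:
  assumes "poly_subst q g \<noteq> 0"
  shows "Fract p q \<circ>\<^sub>R g = poly_subst p g / poly_subst q g"
  unfolding ratfun_comp_def
proof (rule the_equality)
  show "\<exists>p' q'. Fract p q = Fract p' q' \<and> poly_subst q' g \<noteq> 0 \<and>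
          poly_subst p g / poly_subst q g = poly_subst p' g / poly_subst q' g"
    using assms by blast
next
  fix h
  assume "\<exists>p' q'. Fract p q = Fract p' q' \<and> poly_subst q' g \<noteq> 0 \<and>
            h = poly_subst p' g / poly_subst q' g"
  then obtain p' q' where *: "Fract p q = Fract p' q'" "poly_subst q' g \<noteq> 0"
      "h = poly_subst p' g / poly_subst q' g"
    by blast
  have "q \<noteq> 0" "q' \<noteq> 0"
    using assms * by auto
  then have "p * q' = p' * q"
    using *(1) by (simp add: eq_fract)
  then have "poly_subst p g * poly_subst q' g = poly_subst p' g * poly_subst q g"
    by (simp flip: poly_subst_mult)
  then show "h = poly_subst p g / poly_subst q g"
    using assms * by (simp add: frac_eq_eq)
qed

lemma ratfun_comp_X_right [simp]: "f \<circ>\<^sub>R ratfun_X = f"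
  by (cases f) (simp add: ratfun_comp_Fract Fract_conv_to_fract[symmetric])

lemma ratfun_comp_X_left [simp]: "ratfun_X \<circ>\<^sub>R g = g"
proof -
  have "ratfun_X \<circ>\<^sub>R g = Fract [:0, 1:] 1 \<circ>\<^sub>R g"
    by (simp add: ratfun_X_def to_fract_def)
  also have "\<dots> = g"
    by (subst ratfun_comp_Fract) (simp_all add: poly_subst_pCons one_pCons)
  finally show ?thesis .
qed

definition ratfun_iter :: "'a::field ratfun \<Rightarrow> nat \<Rightarrow> 'a ratfun" where
  "ratfun_iter f r = ((\<lambda>g. f \<circ>\<^sub>R g) ^^ r) ratfun_X"

definition ratfun_commute :: "'a::field ratfun \<Rightarrow> 'a ratfun \<Rightarrow> bool" where
  "ratfun_commute f g \<longleftrightarrow> f \<circ>\<^sub>R g = g \<circ>\<^sub>R f"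

datatype letter = Letter_F | Letter_G

definition word_comp :: "'a::field ratfun \<Rightarrow> 'a ratfun \<Rightarrow> letter list \<Rightarrow> 'a ratfun" where
  "word_comp f g w =
     foldr (\<lambda>l h. (case l of Letter_F \<Rightarrow> f | Letter_G \<Rightarrow> g) \<circ>\<^sub>R h) w ratfun_X"

definition comp_semigroup :: "'a::field ratfun \<Rightarrow> 'a ratfun \<Rightarrow> 'a ratfun set" where
  "comp_semigroup f g = word_comp f g ` {w. w \<noteq> []}"

definition comp_semigroup_free :: "'a::field ratfun \<Rightarrow> 'a ratfun \<Rightarrow> bool" where
  "comp_semigroup_free f g \<longleftrightarrow> inj_on (word_comp f g) {w. w \<noteq> []}"

definition comp_semigroup_iso ::
  "('a::field ratfun \<Rightarrow> 'a ratfun) \<Rightarrow> 'a ratfun set \<Rightarrow> 'a ratfun set \<Rightarrow> bool" where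
  "comp_semigroup_iso \<phi> S T \<longleftrightarrow>
     bij_betw \<phi> S T \<and> (\<forall>a\<in>S. \<forall>b\<in>S. \<phi> (a \<circ>\<^sub>R b) = \<phi> a \<circ>\<^sub>R \<phi> b)"

definition is_root_of_unity :: "'a::field \<Rightarrow> bool" where
  "is_root_of_unity c \<longleftrightarrow> (\<exists>k::nat. k > 0 \<and> c ^ k = 1)"

end

theory Submission
  imports Defs
begin

text \<open>
  Near infinity, \<open>F\<close> behaves like \<open>X\<^sup>m\<close>: since \<open>m\<close> is invertible in the field, a formal change of
  coordinate (the Boettcher coordinate) turns \<open>F\<close> into exactly \<open>X\<^sup>m\<close>. The heart of the proof is
  that a single coincidence between two different words forces the same coordinate to turn \<open>G\<close>
  into a monomial \<open>\<gamma> X\<^sup>n\<close>. Composition of rational functions of positive degree can be cancelled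
  on the right, so the two words may be assumed to end in different letters:
  \<open>u \<circ> F = v \<circ> G\<close> for words \<open>u\<close>, \<open>v\<close>. In the coordinate in which \<open>F\<close> is \<open>X\<^sup>m\<close>, suppose that
  \<open>G\<close> is \<open>\<gamma> X\<^sup>n (1 + b X\<^sup>-\<^sup>k + \<dots>)\<close> with \<open>b \<noteq> 0\<close>. In \<open>v \<circ> G\<close> the innermost letter contributes a
  relative error of order exactly \<open>k\<close>, because the degree of \<open>v\<close> is invertible in the field. Every
  other occurrence of \<open>G\<close>, in either word, is precomposed with at least one letter, which
  multiplies the order of its error by \<open>m\<close> or \<open>n\<close> at least. So the two words differ at order \<open>k\<close>,
  a contradiction.

  The coordinate is a power series, which the proof replaces by its truncations: for each \<open>k\<close>, a
  rational function \<open>\<phi>\<close> with \<open>\<phi> \<circ> F = \<phi>\<^sup>m \<epsilon>\<close> and \<open>\<phi> \<circ> G = \<gamma> \<phi>\<^sup>n \<epsilon>'\<close>, where \<open>\<epsilon>\<close> and \<open>\<epsilon>'\<close> agree with 1 to order \<open>k\<close> at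
  infinity. Replacing \<open>\<phi>\<close> by \<open>\<phi> (1 + e X\<^sup>-\<^sup>k)\<close> with a suitable constant \<open>e\<close> improves the order of \<open>\<epsilon>\<close> by
  one, and the argument above then improves \<open>\<epsilon>'\<close> as well (\<open>improve_linearisation\<close>).

  Each word \<open>w\<close> has a degree \<open>d\<close> and a twist \<open>e\<close>, the exponents for which its value in the
  letters \<open>X\<^sup>m\<close> and \<open>\<gamma> X\<^sup>n\<close> is \<open>\<gamma>\<^sup>e X\<^sup>d\<close>. Once such \<open>\<phi>\<close> exist to all orders, two words in \<open>F\<close>
  and \<open>G\<close> coincide iff they have the same \<open>d\<close> and the same \<open>\<gamma>\<^sup>e\<close> (\<open>word_eq_iff_of_linearisable\<close>),
  so they obey the same relations as the words in the two monomials. Two words of the same degree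
  ending in different letters have different twists (\<open>word_twist_neq\<close>), so the coincidence
  \<open>u \<circ> F = v \<circ> G\<close> also makes \<open>\<gamma>\<close> a root of unity. The commutation relations then say that
  certain powers of \<open>m\<close> are congruent modulo the order of \<open>\<gamma>\<close>, which holds because the sequence of
  these powers is eventually periodic.
\<close>

section \<open>Degree of a rational function\<close>

text \<open>This is the order of the pole at infinity, negative at a zero. The value at 0 is a default.\<close>

definition rdeg :: "'a::field ratfun \<Rightarrow> int" where
  "rdeg x = (if x = 0 then 0 else THE k. \<exists>a b. a \<noteq> 0 \<and> b \<noteq> 0 \<and> x = Fract a b \<and> k = int (degree a) - int (degree b))"

lemma rdeg_Fract:
  assumes "a \<noteq> 0" "b \<noteq> 0"
  shows "rdeg (Fract a b) = int (degree a) - int (degree b)"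
proof -
  have "(THE k. \<exists>a' b'. a' \<noteq> 0 \<and> b' \<noteq> 0 \<and> Fract a b = Fract a' b' \<and>
          k = int (degree a') - int (degree b')) = int (degree a) - int (degree b)"
  proof (rule the_equality)
  fix k
  assume "\<exists>a' b'. a' \<noteq> 0 \<and> b' \<noteq> 0 \<and> Fract a b = Fract a' b' \<and> k = int (degree a') - int (degree b')"
  then obtain a' b' where *: "a' \<noteq> 0" "b' \<noteq> 0" "Fract a b = Fract a' b'"
      "k = int (degree a') - int (degree b')"
    by blast
  then have "a * b' = a' * b"
    using assms by (simp add: eq_fract)
  then have "degree a + degree b' = degree a' + degree b"
    using assms * by (metis degree_mult_eq)
  then show "k = int (degree a) - int (degree b)"
    using * by linarith
  qed (use assms in blast)
  then show ?thesis
    using assms by (simp add: rdeg_def eq_fract Zero_fract_def)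
qed

lemma nonzero_ratfun_cases:
  assumes "x \<noteq> (0::'a::field ratfun)"
  obtains a b where "x = Fract a b" "a \<noteq> 0" "b \<noteq> 0"
  using assms by (cases x rule: Fract_cases_nonzero) (auto simp: eq_fract Zero_fract_def)

lemma rdeg_mult:
  assumes "x \<noteq> 0" "y \<noteq> 0"
  shows "rdeg (x * y) = rdeg x + rdeg y"
proof -
  obtain a b c d where "x = Fract a b" "a \<noteq> 0" "b \<noteq> 0" "y = Fract c d" "c \<noteq> 0" "d \<noteq> 0"
    using assms nonzero_ratfun_cases by metis
  then show ?thesis
    by (simp add: rdeg_Fract degree_mult_eq)
qed

lemma ratfun_const_uminus: "ratfun_const (- c) = - ratfun_const c"
  by (simp add: ratfun_const_def flip: to_fract_uminus)

lemma ratfun_const_eq_0_iff [simp]: "ratfun_const c = 0 \<longleftrightarrow> c = 0"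
  using ratfun_const_simps(5)[of c 0] by simp

lemma ratfun_const_power: "ratfun_const (c ^ k) = ratfun_const c ^ k"
  by (induction k) simp_all

lemma ratfun_const_of_nat: "ratfun_const (of_nat k) = of_nat k"
  by (induction k) simp_all

lemma ratfun_const_diff: "ratfun_const (a - b) = ratfun_const a - ratfun_const b"
  using ratfun_const_simps(3)[of a "- b"] by (simp add: ratfun_const_uminus)

lemma ratfun_const_divide:
  "ratfun_const (a / b) = ratfun_const a / ratfun_const b"
proof (cases "b = 0")
  case False
  have "ratfun_const (a / b) * ratfun_const b = ratfun_const a"
    using False by (simp flip: ratfun_const_simps(4))
  then show ?thesis
    using False by (simp add: field_simps)
qed simp

lemma rdeg_const [simp]: "rdeg (ratfun_const c) = 0"
proof (cases "c = 0")
  case False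
  then show ?thesis
    by (simp add: ratfun_const_def to_fract_def rdeg_Fract)
qed (simp add: rdeg_def)

lemma rdeg_X [simp]: "rdeg ratfun_X = 1"
  by (simp add: ratfun_X_def to_fract_def rdeg_Fract)

lemma ratfun_X_neq_0 [simp]: "ratfun_X \<noteq> 0"
  by (simp add: ratfun_X_def)

lemma rdeg_0 [simp]: "rdeg 0 = 0"
  by (simp add: rdeg_def)

lemma rdeg_1 [simp]: "rdeg 1 = 0"
  using rdeg_const[of 1] by simp

lemma rdeg_inverse: "rdeg (inverse x) = - rdeg x"
proof (cases "x = 0")
  case False
  then have "rdeg x + rdeg (inverse x) = rdeg 1"
    by (simp flip: rdeg_mult)
  then show ?thesis
    by simp
qed simp

lemma rdeg_divide: "x \<noteq> 0 \<Longrightarrow> y \<noteq> 0 \<Longrightarrow> rdeg (x / y) = rdeg x - rdeg y"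
  by (simp add: divide_inverse rdeg_mult rdeg_inverse)

lemma rdeg_power: "rdeg (x ^ k) = int k * rdeg x"
proof (cases "x = 0")
  case False
  then show ?thesis
    by (induction k) (simp_all add: rdeg_mult algebra_simps)
qed (cases k; simp)

text \<open>The term with the dominant pole cannot be cancelled.\<close>

lemma rdeg_add_less:
  assumes "rdeg x < rdeg y \<or> x = 0" "y \<noteq> 0"
  shows "x + y \<noteq> 0 \<and> rdeg (x + y) = rdeg y"
proof (cases "x = 0")
  case False
  then obtain a b c d where *: "x = Fract a b" "a \<noteq> 0" "b \<noteq> 0" "y = Fract c d" "c \<noteq> 0" "d \<noteq> 0"
    using assms nonzero_ratfun_cases by metis
  then have "degree (a * d) < degree (c * b)"
    using assms False by (simp add: rdeg_Fract degree_mult_eq)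
  then have deg: "degree (a * d + c * b) = degree (c * b)"
    by (rule degree_add_eq_right)
  have nz: "a * d + c * b \<noteq> 0"
  proof
    assume "a * d + c * b = 0"
    then have "degree (a * d) = degree (c * b)"
      by (metis degree_minus eq_neg_iff_add_eq_0)
    with \<open>degree (a * d) < degree (c * b)\<close> show False
      by simp
  qed
  have "x + y = Fract (a * d + c * b) (b * d)"
    using * by simp
  then show ?thesis
    using nz deg * by (simp add: rdeg_Fract degree_mult_eq eq_fract Zero_fract_def)
qed (use assms in simp)

definition rdeg_le :: "int \<Rightarrow> 'a::field ratfun \<Rightarrow> bool" where
  "rdeg_le k x \<longleftrightarrow> x = 0 \<or> rdeg x \<le> k"

lemma rdeg_le_0 [simp]: "rdeg_le k 0"
  by (simp add: rdeg_le_def)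

lemma rdeg_le_mono: "rdeg_le k x \<Longrightarrow> k \<le> l \<Longrightarrow> rdeg_le l x"
  by (auto simp: rdeg_le_def)

lemma rdeg_le_mult: "rdeg_le k x \<Longrightarrow> rdeg_le l y \<Longrightarrow> rdeg_le (k + l) (x * y)"
  by (cases "x = 0 \<or> y = 0") (auto simp: rdeg_le_def rdeg_mult)

lemma rdeg_le_const [simp]: "0 \<le> k \<Longrightarrow> rdeg_le k (ratfun_const c)"
  by (simp add: rdeg_le_def)

lemma rdeg_le_uminus [simp]: "rdeg_le k (- x) \<longleftrightarrow> rdeg_le k x"
proof -
  have "rdeg (- x) = rdeg x"
  proof (cases "x = 0")
    case False
    have "rdeg (- x) = rdeg (ratfun_const (- 1) * x)"
      by (simp add: ratfun_const_uminus)
    also have "\<dots> = rdeg x"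
      by (subst rdeg_mult) (use False in simp_all)
    finally show ?thesis .
  qed simp
  then show ?thesis
    by (simp add: rdeg_le_def)
qed

lemma rdeg_le_add:
  assumes "rdeg_le k x" "rdeg_le k y"
  shows "rdeg_le k (x + y)"
proof (cases "x = 0 \<or> y = 0")
  case False
  then obtain a b c d where *: "x = Fract a b" "a \<noteq> 0" "b \<noteq> 0" "y = Fract c d" "c \<noteq> 0" "d \<noteq> 0"
    using nonzero_ratfun_cases by metis
  have "int (degree (a * d)) \<le> k + degree (b * d)" "int (degree (c * b)) \<le> k + degree (b * d)"
    using assms False * by (auto simp add: rdeg_le_def rdeg_Fract degree_mult_eq)
  then have "int (degree (a * d + c * b)) \<le> k + degree (b * d)"
    using degree_add_le_max[of "a * d" "c * b"] by linarith
  then show ?thesis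
    using * by (cases "a * d + c * b = 0")
      (simp_all add: rdeg_le_def rdeg_Fract eq_fract Zero_fract_def)
qed (use assms in auto)

lemma rdeg_le_diff: "rdeg_le k x \<Longrightarrow> rdeg_le k y \<Longrightarrow> rdeg_le k (x - y)"
  using rdeg_le_add[of k x "- y"] by simp

lemma rdeg_le_sum: "(\<And>i. i \<in> I \<Longrightarrow> rdeg_le k (f i)) \<Longrightarrow> rdeg_le k (sum f I)"
  by (induction I rule: infinite_finite_induct) (auto intro: rdeg_le_add)

text \<open>
  The residue field of the local ring at infinity is the field of constants. This is the only
  source of coefficients in the proof.
\<close>

lemma value_at_infinity_exists:
  assumes "rdeg_le 0 x"
  shows "\<exists>c. rdeg_le (- 1) (x - ratfun_const c)"
proof (cases "x = 0")
  case True
  then show ?thesis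
    by (intro exI[of _ 0]) simp
next
  case False
  then obtain a b where *: "x = Fract a b" "a \<noteq> 0" "b \<noteq> 0"
    by (rule nonzero_ratfun_cases)
  with assms have deg: "degree a \<le> degree b"
    by (simp add: rdeg_le_def rdeg_Fract eq_fract Zero_fract_def)
  define c where "c = coeff a (degree b) / lead_coeff b"
  define r where "r = a - smult c b"
  have eq: "x - ratfun_const c = Fract r b"
    using * by (simp add: ratfun_const_def to_fract_def r_def)
  have "coeff r (degree b) = 0"
    using * by (simp add: r_def c_def)
  moreover have "degree r \<le> degree b"
    using deg by (simp add: r_def degree_diff_le)
  ultimately have "r = 0 \<or> degree r < degree b"
    by (metis leading_coeff_0_iff le_neq_implies_less)
  then have "rdeg_le (- 1) (Fract r b)"
    using * by (cases "r = 0") (auto simp: rdeg_le_def rdeg_Fract eq_fract Zero_fract_def)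
  then show ?thesis
    using eq by metis
qed

section \<open>Composition with a function of positive degree\<close>

text \<open>
  A function with a pole at infinity is transcendental: the top term of \<open>p(f)\<close> dominates the
  others. Hence \<open>x \<mapsto> x \<circ> f\<close> is an embedding of the field of rational functions into itself, and
  the remaining lemmas of this section say that it is a homomorphism.
\<close>

lemma poly_subst_nonzero:
  assumes f: "rdeg f > 0" and "p \<noteq> 0"
  shows "poly_subst p f \<noteq> 0 \<and> rdeg (poly_subst p f) = int (degree p) * rdeg f"
  using assms(2)
proof (induction p)
  case (pCons c p)
  have f0: "f \<noteq> 0"
    using f by auto
  show ?case
  proof (cases "p = 0")
    case True
    then show ?thesis
      using pCons by (simp add: poly_subst_pCons)
  next
    case False
    then have IH: "poly_subst p f \<noteq> 0" "rdeg (poly_subst p f) = int (degree p) * rdeg f"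
      using pCons by auto
    have "rdeg (f * poly_subst p f) = int (Suc (degree p)) * rdeg f"
      using IH f0 by (simp add: rdeg_mult algebra_simps)
    moreover from this have "0 < rdeg (f * poly_subst p f)"
      using f by simp
    ultimately show ?thesis
      using rdeg_add_less[of "ratfun_const c" "f * poly_subst p f"] IH f0 False
      by (simp add: poly_subst_pCons)
  qed
qed simp

lemma poly_subst_eq_0_iff: "rdeg f > 0 \<Longrightarrow> poly_subst p f = 0 \<longleftrightarrow> p = 0"
  using poly_subst_nonzero by fastforce

lemma comp_Fract:
  assumes "rdeg f > 0" "q \<noteq> 0"
  shows "Fract p q \<circ>\<^sub>R f = poly_subst p f / poly_subst q f"
  using assms by (intro ratfun_comp_Fract) (simp add: poly_subst_eq_0_iff)

lemma comp_to_fract: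
  assumes "rdeg f > 0"
  shows "to_fract p \<circ>\<^sub>R f = poly_subst p f"
  using comp_Fract[OF assms, of 1 p] by (simp add: to_fract_def one_pCons poly_subst_pCons)

lemma comp_const:
  assumes "rdeg f > 0"
  shows "ratfun_const c \<circ>\<^sub>R f = ratfun_const c"
  using comp_to_fract[OF assms, of "[:c:]"] by (simp add: ratfun_const_def[of c] poly_subst_pCons)

lemma comp_1: "rdeg f > 0 \<Longrightarrow> 1 \<circ>\<^sub>R f = 1"
  using comp_const[of f 1] by simp

lemma comp_0: "rdeg f > 0 \<Longrightarrow> 0 \<circ>\<^sub>R f = 0"
  using comp_const[of f 0] by simp

lemma comp_add:
  assumes f: "rdeg f > 0"
  shows "(x + y) \<circ>\<^sub>R f = x \<circ>\<^sub>R f + y \<circ>\<^sub>R f"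
proof (cases x rule: Fract_cases_nonzero; cases y rule: Fract_cases_nonzero)
  fix a b c d
  assume "x = Fract a b" "b \<noteq> 0" "y = Fract c d" "d \<noteq> 0"
  then show ?thesis
    using f by (simp add: comp_Fract poly_subst_add poly_subst_mult poly_subst_eq_0_iff field_simps)
qed (use comp_0[OF f] in auto)

lemma comp_mult:
  assumes f: "rdeg f > 0"
  shows "(x * y) \<circ>\<^sub>R f = (x \<circ>\<^sub>R f) * (y \<circ>\<^sub>R f)"
proof (cases x rule: Fract_cases_nonzero; cases y rule: Fract_cases_nonzero)
  fix a b c d
  assume "x = Fract a b" "b \<noteq> 0" "y = Fract c d" "d \<noteq> 0"
  then show ?thesis
    using f by (simp add: comp_Fract poly_subst_mult poly_subst_eq_0_iff)
qed (use comp_0[OF f] in auto)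

lemma comp_rdeg_nonzero:
  assumes f: "rdeg f > 0" and "x \<noteq> 0"
  shows "x \<circ>\<^sub>R f \<noteq> 0 \<and> rdeg (x \<circ>\<^sub>R f) = rdeg x * rdeg f"
proof -
  obtain a b where "x = Fract a b" "a \<noteq> 0" "b \<noteq> 0"
    using assms(2) by (rule nonzero_ratfun_cases)
  then show ?thesis
    using f by (simp add: comp_Fract poly_subst_nonzero rdeg_divide rdeg_Fract algebra_simps)
qed

lemma rdeg_comp: "rdeg f > 0 \<Longrightarrow> rdeg (x \<circ>\<^sub>R f) = rdeg x * rdeg f"
  using comp_rdeg_nonzero[of f x] comp_0[of f] by (cases "x = 0") auto

lemma comp_eq_0_iff: "rdeg f > 0 \<Longrightarrow> x \<circ>\<^sub>R f = 0 \<longleftrightarrow> x = 0"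
  using comp_rdeg_nonzero[of f x] comp_0[of f] by auto

lemma comp_uminus: "rdeg f > 0 \<Longrightarrow> (- x) \<circ>\<^sub>R f = - (x \<circ>\<^sub>R f)"
  using comp_add[of f x "- x"] comp_0[of f] by (simp add: add_eq_0_iff)

lemma comp_diff: "rdeg f > 0 \<Longrightarrow> (x - y) \<circ>\<^sub>R f = x \<circ>\<^sub>R f - y \<circ>\<^sub>R f"
  using comp_add[of f x "- y"] by (simp add: comp_uminus)

lemma comp_right_cancel: "rdeg f > 0 \<Longrightarrow> x \<circ>\<^sub>R f = y \<circ>\<^sub>R f \<longleftrightarrow> x = y"
  using comp_eq_0_iff[of f "x - y"] by (simp add: comp_diff)

lemma comp_power: "rdeg f > 0 \<Longrightarrow> (x ^ k) \<circ>\<^sub>R f = (x \<circ>\<^sub>R f) ^ k"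
  by (induction k) (simp_all add: comp_1 comp_mult)

lemma comp_inverse:
  assumes "rdeg f > 0"
  shows "inverse x \<circ>\<^sub>R f = inverse (x \<circ>\<^sub>R f)"
proof (cases "x = 0")
  case False
  then have "(x \<circ>\<^sub>R f) * (inverse x \<circ>\<^sub>R f) = 1"
    using assms by (simp add: comp_1 flip: comp_mult)
  then show ?thesis
    by (metis inverse_unique)
qed (use assms in \<open>simp add: comp_0\<close>)

lemma comp_divide: "rdeg f > 0 \<Longrightarrow> (x / y) \<circ>\<^sub>R f = (x \<circ>\<^sub>R f) / (y \<circ>\<^sub>R f)"
  by (simp add: divide_inverse comp_mult comp_inverse)

lemma poly_subst_comp:
  "rdeg g > 0 \<Longrightarrow> poly_subst p f \<circ>\<^sub>R g = poly_subst p (f \<circ>\<^sub>R g)"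
  by (induction p) (simp_all add: poly_subst_pCons comp_0 comp_add comp_mult comp_const)

lemma comp_assoc:
  assumes "rdeg f > 0" "rdeg g > 0"
  shows "(x \<circ>\<^sub>R f) \<circ>\<^sub>R g = x \<circ>\<^sub>R (f \<circ>\<^sub>R g)"
proof (cases x rule: Fract_cases_nonzero)
  case (Fract a b)
  then show ?thesis
    using assms by (simp add: comp_Fract rdeg_comp comp_divide poly_subst_comp)
next
  case 0
  then show ?thesis
    using assms by (simp add: comp_0 rdeg_comp)
qed

section \<open>Functions close to 1 at infinity\<close>

text \<open>These are the higher unit groups of the local ring at infinity.\<close>

definition near_one :: "nat \<Rightarrow> 'a::field ratfun \<Rightarrow> bool" where
  "near_one k x \<longleftrightarrow> rdeg_le (- int k) (x - 1)"

lemma near_one_1 [simp]: "near_one k 1"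
  by (simp add: near_one_def)

lemma near_one_mono: "near_one k x \<Longrightarrow> l \<le> k \<Longrightarrow> near_one l x"
  unfolding near_one_def by (erule rdeg_le_mono) simp

lemma near_one_nonzero:
  assumes "near_one k x" "k \<ge> 1"
  shows "x \<noteq> 0 \<and> rdeg x = 0"
proof -
  have "rdeg (x - 1) < rdeg 1 \<or> x - 1 = 0"
    using assms by (auto simp: near_one_def rdeg_le_def)
  from rdeg_add_less[OF this] show ?thesis
    by simp
qed

lemma near_one_mult:
  assumes "near_one k x" "near_one k y"
  shows "near_one k (x * y)"
proof -
  have "rdeg_le (- int k) ((x - 1) * (y - 1))"
    using rdeg_le_mult[OF assms[unfolded near_one_def]] by (rule rdeg_le_mono) simp
  then have "rdeg_le (- int k) ((x - 1) * (y - 1) + (x - 1) + (y - 1))"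
    using assms by (intro rdeg_le_add) (simp_all add: near_one_def)
  then show ?thesis
    by (simp add: near_one_def algebra_simps)
qed

lemma near_one_power: "near_one k x \<Longrightarrow> near_one k (x ^ j)"
  by (induction j) (auto intro: near_one_mult)

lemma near_one_divide_iff:
  assumes "y \<noteq> 0" "rdeg y = 0"
  shows "near_one k (x / y) \<longleftrightarrow> rdeg_le (- int k) (x - y)"
proof -
  have eq: "(x / y - 1) * y = x - y" "(x - y) * inverse y = x / y - 1"
    using assms by (simp_all add: field_simps)
  have y: "rdeg_le 0 y" "rdeg_le 0 (inverse y)"
    using assms by (simp_all add: rdeg_le_def rdeg_inverse)
  show ?thesis
    using rdeg_le_mult[OF _ y(1), of "- int k" "x / y - 1"]
      rdeg_le_mult[OF _ y(2), of "- int k" "x - y"]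
    unfolding near_one_def eq by auto
qed

lemma near_one_divide:
  assumes "near_one k x" "near_one k y" "k \<ge> 1"
  shows "near_one k (x / y)"
  using rdeg_le_diff[OF assms(1,2)[unfolded near_one_def]] near_one_nonzero[OF assms(2,3)]
  by (simp add: near_one_divide_iff)

text \<open>
  Precomposition with a function of degree \<open>d\<close> multiplies the order of the error by \<open>d\<close>, because
  infinity is a fixed point of multiplicity \<open>d\<close>.
\<close>

lemma near_one_comp:
  assumes f: "rdeg f = int d" "d > 0" and x: "near_one k x"
  shows "near_one (d * k) (x \<circ>\<^sub>R f)"
proof -
  have "(x \<circ>\<^sub>R f) - 1 = (x - 1) \<circ>\<^sub>R f"
    using f by (simp add: comp_diff comp_1)
  moreover have "rdeg_le (- int (d * k)) ((x - 1) \<circ>\<^sub>R f)"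
  proof (cases "x - 1 = 0")
    case False
    then have "int d * rdeg (x - 1) \<le> int d * (- int k)"
      using x f by (intro mult_left_mono) (auto simp: near_one_def rdeg_le_def)
    then show ?thesis
      using f by (simp add: rdeg_le_def rdeg_comp mult.commute)
  qed (use f in \<open>simp add: comp_0\<close>)
  ultimately show ?thesis
    by (simp add: near_one_def)
qed

lemma near_one_const:
  assumes "near_one k (ratfun_const c)" "k \<ge> 1"
  shows "c = 1"
proof -
  have "rdeg_le (- int k) (ratfun_const (c - 1))"
    using assms by (simp add: near_one_def ratfun_const_diff)
  then show ?thesis
    using assms(2) by (simp add: rdeg_le_def)
qed

text \<open>This replaces a comparison of leading coefficients.\<close>

lemma near_one_const_mult_unique:
  assumes "ratfun_const a * x = ratfun_const b * y" "near_one k x" "near_one k y" "k \<ge> 1" "b \<noteq> 0"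
  shows "a = b \<and> x = y"
proof -
  have nz: "x \<noteq> 0" "y \<noteq> 0"
    using assms near_one_nonzero by metis+
  have "ratfun_const (a / b) = y / x"
    using assms nz by (simp add: ratfun_const_divide field_simps)
  then have "a / b = 1"
    using near_one_divide[OF assms(3,2,4)] near_one_const[OF _ assms(4)] by metis
  then have "a = b"
    using assms by simp
  with assms show ?thesis
    by auto
qed

lemma near_one_all_imp_eq_1:
  assumes "\<And>k. k \<ge> 1 \<Longrightarrow> near_one k x"
  shows "x = 1"
proof (rule ccontr)
  assume "x \<noteq> 1"
  then have "rdeg (x - 1) \<le> - int (Suc (nat \<bar>rdeg (x - 1)\<bar>))"
    using assms[of "Suc (nat \<bar>rdeg (x - 1)\<bar>)"] by (auto simp: near_one_def rdeg_le_def)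
  then show False
    by linarith
qed

text \<open>
  To first order, raising to the power \<open>d\<close> multiplies the error by \<open>d\<close>. This is where
  invertibility of \<open>m\<close> and \<open>n\<close> in the field comes in: the next lemmas recover an error from that
  of a power, and take approximate roots.
\<close>

lemma near_one_power_minus_1:
  assumes "near_one k x" "k \<ge> 1"
  obtains s where "x ^ d - 1 = (x - 1) * s" "rdeg_le (- int k) (s - of_nat d)"
proof
  show "x ^ d - 1 = (x - 1) * (\<Sum>i<d. x ^ i)"
    by (rule power_diff_1_eq)
  have "(\<Sum>i<d. x ^ i) - of_nat d = (\<Sum>i<d. x ^ i - 1)"
    by (simp add: sum_subtractf)
  also have "rdeg_le (- int k) \<dots>"
    using near_one_power[OF assms(1)] by (intro rdeg_le_sum) (simp add: near_one_def)
  finally show "rdeg_le (- int k) ((\<Sum>i<d. x ^ i) - of_nat d)" .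
qed

lemma near_one_power_cancel:
  fixes x :: "'a::field ratfun"
  assumes x: "near_one k x" "k \<ge> 1" and d: "of_nat d \<noteq> (0::'a)" and xd: "near_one l (x ^ d)"
  shows "near_one l x"
proof -
  obtain s where s: "x ^ d - 1 = (x - 1) * s" "rdeg_le (- int k) (s - of_nat d)"
    using near_one_power_minus_1[OF x] .
  have "rdeg (s - of_nat d) < rdeg (ratfun_const (of_nat d :: 'a)) \<or> s - of_nat d = 0"
    using s(2) x(2) by (auto simp: rdeg_le_def)
  from rdeg_add_less[OF this] d
  have "s - of_nat d + ratfun_const (of_nat d) \<noteq> 0" "rdeg (s - of_nat d + ratfun_const (of_nat d)) = 0"
    by (metis ratfun_const_eq_0_iff rdeg_const)+
  then have "s \<noteq> 0" "rdeg s = 0"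
    by (simp_all add: ratfun_const_of_nat)
  then have "rdeg_le 0 (inverse s)" "x - 1 = (x ^ d - 1) * inverse s"
    using s(1) by (simp_all add: rdeg_le_def rdeg_inverse)
  then show ?thesis
    using rdeg_le_mult[of "- int l" "x ^ d - 1" 0] xd by (simp add: near_one_def)
qed

lemma leading_term_exists:
  assumes x: "rdeg x = int d" "d > 0"
  obtains a where "a \<noteq> 0" "near_one 1 (x / (ratfun_const a * ratfun_X ^ d))"
proof -
  have x0: "x \<noteq> 0"
    using x by auto
  define y where "y = x / ratfun_X ^ d"
  have y: "y \<noteq> 0" "rdeg y = 0"
    using x x0 by (simp_all add: y_def rdeg_divide rdeg_power)
  then obtain a where a: "rdeg_le (- 1) (y - ratfun_const a)"
    using value_at_infinity_exists[of y] by (auto simp: rdeg_le_def)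
  have "a \<noteq> 0"
    using a y by (auto simp: rdeg_le_def)
  moreover have "near_one 1 (y / ratfun_const a)"
    using a \<open>a \<noteq> 0\<close> by (simp add: near_one_divide_iff)
  ultimately show ?thesis
    using that by (simp add: y_def mult.commute)
qed

definition one_plus_monom :: "'a::field \<Rightarrow> nat \<Rightarrow> 'a ratfun" where
  "one_plus_monom e k = 1 + ratfun_const e * inverse (ratfun_X ^ k)"

lemma comp_one_plus_monom:
  "rdeg f > 0 \<Longrightarrow> one_plus_monom e k \<circ>\<^sub>R f = 1 + ratfun_const e * inverse (f ^ k)"
  by (simp add: one_plus_monom_def comp_add comp_1 comp_mult comp_const comp_inverse comp_power)

lemma near_one_one_plus_monom: "near_one k (one_plus_monom e k)"
  using rdeg_le_mult[of 0 "ratfun_const e" "- int k" "inverse (ratfun_X ^ k)"]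
  by (simp add: near_one_def one_plus_monom_def rdeg_le_def rdeg_inverse rdeg_power)

lemma near_one_root_approx:
  fixes x :: "'a::field ratfun"
  assumes x: "near_one k x" "k \<ge> 1" and m: "of_nat m \<noteq> (0::'a)"
  obtains e where "near_one (Suc k) (x / one_plus_monom e k ^ m)"
proof -
  have "rdeg_le (- int k + int k) ((x - 1) * ratfun_X ^ k)"
    using x by (intro rdeg_le_mult) (simp_all add: near_one_def rdeg_le_def rdeg_power)
  then obtain c where c: "rdeg_le (- 1) ((x - 1) * ratfun_X ^ k - ratfun_const c)"
    using value_at_infinity_exists by fastforce
  (* 1 + c X^-k is the start of the expansion of x, so its m-th root starts with 1 + (c / m) X^-k *)
  define e where "e = c / of_nat m"
  define u where "u = one_plus_monom e k"
  have u: "near_one k u"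
    by (simp add: u_def near_one_one_plus_monom)
  obtain s where s: "u ^ m - 1 = (u - 1) * s" "rdeg_le (- int k) (s - of_nat m)"
    using near_one_power_minus_1[OF u x(2)] .
  have um: "(u - 1) * of_nat m = ratfun_const c * inverse (ratfun_X ^ k)"
  proof -
    have "ratfun_const e * ratfun_const (of_nat m) = ratfun_const c"
      using m by (simp add: e_def flip: ratfun_const_simps(4))
    then show ?thesis
      by (simp add: u_def one_plus_monom_def ratfun_const_of_nat mult_ac)
  qed
  have "rdeg_le (- int k + - int k) ((u - 1) * (s - of_nat m))"
    using s(2) u by (intro rdeg_le_mult) (simp_all add: near_one_def)
  then have 1: "rdeg_le (- int (Suc k)) ((u - 1) * (s - of_nat m))"
    by (rule rdeg_le_mono) (use x in simp)
  have "rdeg_le (- 1 + - int k) (((x - 1) * ratfun_X ^ k - ratfun_const c) * inverse (ratfun_X ^ k))"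
    using c by (intro rdeg_le_mult) (simp_all add: rdeg_le_def rdeg_inverse rdeg_power)
  then have 2: "rdeg_le (- int (Suc k)) ((x - 1) - (u - 1) * of_nat m)"
    unfolding um by (simp add: algebra_simps)
  have "x - u ^ m = ((x - 1) - (u - 1) * of_nat m) - (u - 1) * (s - of_nat m)"
    using s(1) by (simp add: algebra_simps)
  then have "rdeg_le (- int (Suc k)) (x - u ^ m)"
    using rdeg_le_diff[OF 2 1] by (simp only:)
  moreover have "u ^ m \<noteq> 0" "rdeg (u ^ m) = 0"
    using near_one_nonzero[OF u x(2)] by (simp_all add: rdeg_power)
  ultimately have "near_one (Suc k) (x / u ^ m)"
    by (simp add: near_one_divide_iff)
  then show ?thesis
    using that unfolding u_def by blast
qed


section \<open>Degree and twist of a word\<close>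

text \<open>
  With letters \<open>X\<^sup>m\<close> and \<open>\<gamma> X\<^sup>n\<close>, a word of degree \<open>d\<close> and twist \<open>e\<close> evaluates to \<open>\<gamma>\<^sup>e X\<^sup>d\<close>.
  Equivalently, \<open>z \<mapsto> d z + e\<close> is the value of the word in the letters \<open>z \<mapsto> m z\<close> and
  \<open>z \<mapsto> n z + 1\<close>.
\<close>

primrec word_deg :: "nat \<Rightarrow> nat \<Rightarrow> letter list \<Rightarrow> nat" where
  "word_deg m n [] = 1"
| "word_deg m n (l # w) = (case l of Letter_F \<Rightarrow> m | Letter_G \<Rightarrow> n) * word_deg m n w"

primrec word_twist :: "nat \<Rightarrow> nat \<Rightarrow> letter list \<Rightarrow> nat" where
  "word_twist m n [] = 0"
| "word_twist m n (l # w) =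
     (case l of Letter_F \<Rightarrow> m * word_twist m n w | Letter_G \<Rightarrow> 1 + n * word_twist m n w)"

lemma word_deg_append: "word_deg m n (u @ v) = word_deg m n u * word_deg m n v"
  by (induction u) (simp_all split: letter.split)

lemma word_twist_append:
  "word_twist m n (u @ v) = word_twist m n u + word_deg m n u * word_twist m n v"
  by (induction u) (simp_all add: algebra_simps split: letter.split)

lemma word_deg_replicate_F: "word_deg m n (replicate k Letter_F) = m ^ k"
  by (induction k) simp_all

lemma word_twist_replicate_F: "word_twist m n (replicate k Letter_F) = 0"
  by (induction k) simp_all

lemma word_deg_pos: "m > 0 \<Longrightarrow> n > 0 \<Longrightarrow> word_deg m n w > 0"
  by (induction w) (simp_all split: letter.split)

lemma word_deg_gt_1:
  assumes "m > 1" "n > 1" "w \<noteq> []"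
  shows "word_deg m n w > 1"
proof (cases w)
  case (Cons l w')
  have "word_deg m n w' > 0"
    using assms by (intro word_deg_pos) simp_all
  then have "m \<le> m * word_deg m n w'" "n \<le> n * word_deg m n w'"
    by simp_all
  then show ?thesis
    using assms Cons by (cases l) (auto intro: less_le_trans simp del: mult_le_cancel1)
qed (use assms in simp)

text \<open>
  The inverse branches \<open>z \<mapsto> z / m\<close> and \<open>z \<mapsto> (z - 1) / n\<close> preserve the half-open interval from
  \<open>- 1 / (n - 1)\<close> (excluded) to 0, and the inverse of the affine map of a word takes 0 to minus the
  quotient of twist and degree. The bound says that this quotient is less than \<open>1 / (n - 1)\<close>, with
  the denominators cleared.
\<close>

lemma word_twist_less:
  assumes "m > 1" "n > 1"
  shows "word_twist m n w * n < word_deg m n w + word_twist m n w"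
proof (induction w rule: rev_induct)
  case (snoc l w)
  have "word_deg m n w \<le> word_deg m n w * m"
    using assms by simp
  with snoc have "word_twist m n w * n < word_deg m n w * m + word_twist m n w"
    by linarith
  with snoc show ?case
    by (cases l) (simp_all add: word_deg_append word_twist_append algebra_simps)
qed simp

text \<open>
  This is a ping-pong argument: the images of that interval under the two inverse branches are
  disjoint. A last letter \<open>F\<close> makes the quotient of twist and degree less than \<open>1 / (m (n - 1))\<close>,
  a last letter \<open>G\<close> makes it at least \<open>1 / n\<close>, and \<open>1 / (m (n - 1)) \<le> 1 / n\<close>.
\<close>

lemma word_twist_neq:
  assumes mn: "m > 1" "n > 1"
    and deg: "word_deg m n (u @ [Letter_F]) = word_deg m n (v @ [Letter_G])"
  shows "word_twist m n (u @ [Letter_F]) \<noteq> word_twist m n (v @ [Letter_G])"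
proof
  assume eq: "word_twist m n (u @ [Letter_F]) = word_twist m n (v @ [Letter_G])"
  define t du dv where "t = word_twist m n u" and "du = word_deg m n u" and "dv = word_deg m n v"
  have "t \<ge> dv"
    using eq by (simp add: word_twist_append t_def dv_def)
  have "t * (n - 1) < du"
  proof -
    have "t \<le> t * n"
      using mn by simp
    then show ?thesis
      using word_twist_less[OF mn, of u]
      by (simp add: t_def du_def diff_mult_distrib2 less_diff_conv2)
  qed
  then have "dv * (n - 1) < du"
    using \<open>t \<ge> dv\<close> by (meson le_less_trans mult_le_mono1)
  then have "dv * (n - 1) * m < du * m"
    using mn by simp
  also have "\<dots> = dv * n"
    using deg by (simp add: word_deg_append du_def dv_def)
  also have "\<dots> \<le> dv * ((n - 1) * 2)"
    using mn by (intro mult_le_mono2) simp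
  also have "\<dots> \<le> dv * (n - 1) * m"
    using mn by simp
  finally show False
    by simp
qed

section \<open>Words in a pair of rational functions\<close>

locale ratfun_pair =
  fixes F G :: "'a::field ratfun" and m n :: nat
  assumes m_gt_1: "m > 1" and n_gt_1: "n > 1"
    and m_unit: "of_nat m \<noteq> (0::'a)" and n_unit: "of_nat n \<noteq> (0::'a)"
    and rdeg_F: "rdeg F = int m" and rdeg_G: "rdeg G = int n"
begin

abbreviation wd where "wd \<equiv> word_comp F G"
abbreviation dg where "dg \<equiv> word_deg m n"
abbreviation tw where "tw \<equiv> word_twist m n"

lemma dg_pos: "dg w > 0"
  using m_gt_1 n_gt_1 by (simp add: word_deg_pos)

lemma of_nat_dg: "of_nat (dg w) \<noteq> (0::'a)"
  using m_unit n_unit by (induction w) (simp_all split: letter.split)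

lemma wd_Nil: "wd [] = ratfun_X"
  by (simp add: word_comp_def)

lemma wd_Cons: "wd (l # w) = (case l of Letter_F \<Rightarrow> F | Letter_G \<Rightarrow> G) \<circ>\<^sub>R wd w"
  by (simp add: word_comp_def)

lemma rdeg_wd: "rdeg (wd w) = int (dg w)"
proof (induction w)
  case (Cons l w)
  then show ?case
    using dg_pos[of w] by (simp add: wd_Cons rdeg_comp rdeg_F rdeg_G split: letter.split)
qed (simp add: wd_Nil)

lemma rdeg_wd_pos: "rdeg (wd w) > 0"
  using dg_pos by (simp add: rdeg_wd)

lemma wd_append: "wd (u @ v) = wd u \<circ>\<^sub>R wd v"
  by (induction u) (simp_all add: wd_Nil wd_Cons comp_assoc rdeg_wd_pos)

lemma wd_F: "wd [Letter_F] = F" and wd_G: "wd [Letter_G] = G"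
  by (simp_all add: wd_Cons wd_Nil)

lemma wd_replicate_F: "wd (replicate r Letter_F) = ratfun_iter F r"
  by (induction r) (simp_all add: ratfun_iter_def wd_Nil wd_Cons)

lemma wd_replicate_G: "wd (replicate r Letter_G) = ratfun_iter G r"
  by (induction r) (simp_all add: ratfun_iter_def wd_Nil wd_Cons)

text \<open>
  Strip the common suffix. No word becomes empty in this way, because the degree of a nonempty word
  is greater than 1.
\<close>

lemma coincidence_different_last_letters:
  assumes "wd w = wd w'" "w \<noteq> w'"
  shows "\<exists>u v. wd (u @ [Letter_F]) = wd (v @ [Letter_G])"
  using assms
proof (induction w arbitrary: w' rule: rev_induct)
  case Nil
  then have "dg w' = 1"
    by (metis rdeg_wd of_nat_eq_iff word_deg.simps(1))
  then show ?case
    using word_deg_gt_1[of m n w'] m_gt_1 n_gt_1 Nil by force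
next
  case (snoc a x)
  show ?case
  proof (cases w' rule: rev_cases)
    case Nil
    then have "dg (x @ [a]) = 1"
      using snoc.prems by (metis rdeg_wd of_nat_eq_iff word_deg.simps(1))
    then show ?thesis
      using word_deg_gt_1[of m n "x @ [a]"] m_gt_1 n_gt_1 by force
  next
    case (snoc y b)
    show ?thesis
    proof (cases "a = b")
      case True
      then have "wd x = wd y" "x \<noteq> y"
        using snoc.prems \<open>w' = y @ [b]\<close>
        by (simp_all add: wd_append comp_right_cancel rdeg_wd_pos)
      then show ?thesis
        by (rule snoc.IH)
    next
      case False
      then show ?thesis
        using snoc.prems(1) \<open>w' = y @ [b]\<close> by (cases a; cases b) (auto intro: sym)
    qed
  qed
qed

section \<open>Approximate linearisation\<close>

text \<open>
  If \<open>\<phi>\<close> conjugated \<open>F\<close> to \<open>X\<^sup>m\<close> and \<open>G\<close> to \<open>\<gamma> X\<^sup>n\<close>, then \<open>\<phi> \<circ> w\<close> would be \<open>\<gamma>\<^sup>e \<phi>\<^sup>d\<close> for every word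
  \<open>w\<close> of degree \<open>d\<close> and twist \<open>e\<close>. The quotient of the two sides measures the failure. It is
  multiplicative rather than additive so that words compose by the cocycle rule \<open>err_append\<close>.
\<close>

definition err :: "'a \<Rightarrow> 'a ratfun \<Rightarrow> letter list \<Rightarrow> 'a ratfun" where
  "err \<gamma> \<phi> w = (\<phi> \<circ>\<^sub>R wd w) / (ratfun_const (\<gamma> ^ tw w) * \<phi> ^ dg w)"

definition approx_linear :: "'a \<Rightarrow> nat \<Rightarrow> 'a ratfun \<Rightarrow> bool" where
  "approx_linear \<gamma> k \<phi> \<longleftrightarrow>
     \<phi> \<noteq> 0 \<and> near_one k (err \<gamma> \<phi> [Letter_F]) \<and> near_one k (err \<gamma> \<phi> [Letter_G])"

lemma comp_wd_eq:
  assumes "\<gamma> \<noteq> 0" "\<phi> \<noteq> 0"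
  shows "\<phi> \<circ>\<^sub>R wd w = ratfun_const (\<gamma> ^ tw w) * \<phi> ^ dg w * err \<gamma> \<phi> w"
  using assms by (simp add: err_def)

lemma err_append:
  assumes "\<gamma> \<noteq> 0" "\<phi> \<noteq> 0"
  shows "err \<gamma> \<phi> (u @ v) = err \<gamma> \<phi> v ^ dg u * (err \<gamma> \<phi> u \<circ>\<^sub>R wd v)"
proof -
  have "\<phi> \<circ>\<^sub>R wd (u @ v) = (\<phi> \<circ>\<^sub>R wd u) \<circ>\<^sub>R wd v"
    by (simp add: wd_append comp_assoc rdeg_wd_pos)
  also have "\<dots> = ratfun_const (\<gamma> ^ tw u) * (\<phi> \<circ>\<^sub>R wd v) ^ dg u * (err \<gamma> \<phi> u \<circ>\<^sub>R wd v)"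
    by (subst comp_wd_eq[OF assms]) (simp add: comp_mult comp_const comp_power rdeg_wd_pos)
  also have "\<dots> = ratfun_const (\<gamma> ^ tw (u @ v)) * \<phi> ^ dg (u @ v) *
                    (err \<gamma> \<phi> v ^ dg u * (err \<gamma> \<phi> u \<circ>\<^sub>R wd v))"
    by (subst comp_wd_eq[OF assms, of v])
      (simp add: power_mult_distrib ratfun_const_power word_twist_append word_deg_append
        power_add mult_ac flip: power_mult)
  finally show ?thesis
    using assms by (simp add: err_def[of _ _ "u @ v"])
qed

lemma near_one_comp_wd:
  assumes "near_one k x"
  shows "near_one k (x \<circ>\<^sub>R wd w)"
  using near_one_comp[OF rdeg_wd dg_pos assms] by (rule near_one_mono) (use dg_pos[of w] in simp)

text \<open>One letter of precomposition gains at least one order, since both degrees are at least 2.\<close>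

lemma near_one_comp_letter:
  assumes "near_one k x" "k \<ge> 1"
  shows "near_one (Suc k) (x \<circ>\<^sub>R wd [l])"
proof -
  have "dg [l] \<ge> 2"
    using m_gt_1 n_gt_1 by (cases l) simp_all
  then have "dg [l] * k \<ge> 2 * k"
    by (rule mult_le_mono1)
  then have "Suc k \<le> dg [l] * k"
    using assms(2) by linarith
  with near_one_comp[OF rdeg_wd dg_pos assms(1)] show ?thesis
    by (rule near_one_mono)
qed

lemma near_one_err:
  assumes "\<gamma> \<noteq> 0" "approx_linear \<gamma> k \<phi>"
  shows "near_one k (err \<gamma> \<phi> w)"
proof (induction w rule: rev_induct)
  case Nil
  show ?case
    using assms by (simp add: err_def wd_Nil approx_linear_def)
next
  case (snoc l w)
  have "near_one k (err \<gamma> \<phi> [l])"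
    using assms by (cases l) (auto simp: approx_linear_def)
  with snoc assms show ?case
    unfolding approx_linear_def
    by (subst err_append) (auto intro!: near_one_mult near_one_power near_one_comp_wd)
qed

text \<open>
  The pole order of the common value gives the degree, and the leading coefficient of its image
  under \<open>\<phi>\<close> gives the power of \<open>\<gamma>\<close>. What remains are the two errors.
\<close>

lemma coincidence_imp_same_exponents:
  assumes "\<gamma> \<noteq> 0" "approx_linear \<gamma> k \<phi>" "k \<ge> 1" "wd w = wd w'"
  shows "dg w = dg w'" "\<gamma> ^ tw w = \<gamma> ^ tw w'" "err \<gamma> \<phi> w = err \<gamma> \<phi> w'"
proof -
  have \<phi>: "\<phi> \<noteq> 0"
    using assms by (simp add: approx_linear_def)
  show deg: "dg w = dg w'"
    using assms(4) by (metis rdeg_wd of_nat_eq_iff)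
  have "ratfun_const (\<gamma> ^ tw w) * \<phi> ^ dg w * err \<gamma> \<phi> w =
          ratfun_const (\<gamma> ^ tw w') * \<phi> ^ dg w' * err \<gamma> \<phi> w'"
    using assms \<phi> comp_wd_eq by metis
  then have eq: "ratfun_const (\<gamma> ^ tw w) * err \<gamma> \<phi> w = ratfun_const (\<gamma> ^ tw w') * err \<gamma> \<phi> w'"
    using \<phi> deg by simp
  have "\<gamma> ^ tw w = \<gamma> ^ tw w' \<and> err \<gamma> \<phi> w = err \<gamma> \<phi> w'"
    by (rule near_one_const_mult_unique[OF eq])
      (use assms near_one_err in auto)
  then show "\<gamma> ^ tw w = \<gamma> ^ tw w'" "err \<gamma> \<phi> w = err \<gamma> \<phi> w'"
    by auto
qed


text \<open>
  A coordinate must not bring functions closer together than they are. For \<open>k = 0\<close> the condition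
  would compare only pole orders, so it starts at \<open>k = 1\<close>.
\<close>

definition separating :: "'a ratfun \<Rightarrow> bool" where
  "separating \<phi> \<longleftrightarrow> (\<forall>x y k. rdeg x > 0 \<longrightarrow> rdeg y > 0 \<longrightarrow> k \<ge> 1 \<longrightarrow>
     near_one k ((\<phi> \<circ>\<^sub>R x) / (\<phi> \<circ>\<^sub>R y)) \<longrightarrow> near_one k (x / y))"

lemma separating_linear:
  assumes "c \<noteq> 0"
  shows "separating (ratfun_const c * ratfun_X)"
  using assms by (simp add: separating_def comp_mult comp_const)

text \<open>
  Multiplying \<open>\<phi>\<close> by \<open>u = 1 + e X\<^sup>-\<^sup>k\<close> changes the quotient of \<open>\<phi> \<circ> x\<close> and \<open>\<phi> \<circ> y\<close> by a factor that is
  one order closer to 1 than \<open>x / y\<close> is. The closeness of \<open>x\<close> and \<open>y\<close> can therefore be raised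
  one order at a time.
\<close>

lemma separating_mult_one_plus_monom:
  assumes \<phi>: "separating \<phi>" and k: "k \<ge> 1"
  shows "separating (\<phi> * one_plus_monom e k)"
  unfolding separating_def
proof (intro allI impI)
  fix x y :: "'a ratfun" and j :: nat
  assume x: "rdeg x > 0" and y: "rdeg y > 0" and j: "j \<ge> 1"
  define u where "u z = one_plus_monom e k \<circ>\<^sub>R z" for z
  have u_eq: "u z = 1 + ratfun_const e * inverse (z ^ k)" if "rdeg z > 0" for z
    using that by (simp add: u_def comp_one_plus_monom)
  have u: "near_one 1 (u z)" if "rdeg z > 0" for z
    using that near_one_comp[of z "nat (rdeg z)" k "one_plus_monom e k"] k
    by (intro near_one_mono[where k = "nat (rdeg z) * k" and l = 1])
      (auto simp: u_def near_one_one_plus_monom)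
  have u0: "u z \<noteq> 0" "rdeg (u z) = 0" if "rdeg z > 0" for z
    using near_one_nonzero[OF u[OF that]] by auto
  have correction: "near_one (Suc i) (u x / u y)" if "near_one i (x / y)" "i \<ge> 1" for i
  proof -
    have "u x - u y = - (ratfun_const e * inverse (x ^ k) * ((x / y) ^ k - 1))"
    proof -
      have "x \<noteq> 0" "y \<noteq> 0"
        using x y by auto
      then show ?thesis
        using x y by (simp add: u_eq field_simps power_divide)
    qed
    also have "rdeg_le (- int k + - int i) \<dots>"
    proof -
      have "rdeg_le (- int k) (ratfun_const e * inverse (x ^ k))"
      proof -
        have "int k * 1 \<le> int k * rdeg x"
          using x by (intro mult_left_mono) auto
        then have "rdeg_le (- int k) (inverse (x ^ k))"
          by (simp add: rdeg_le_def rdeg_inverse rdeg_power)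
        then show ?thesis
          using rdeg_le_mult[of 0 "ratfun_const e"] by fastforce
      qed
      then show ?thesis
        using near_one_power[OF that(1), of k]
        by (simp only: rdeg_le_uminus, intro rdeg_le_mult) (auto simp: near_one_def)
    qed
    finally have "rdeg_le (- int (Suc i)) (u x - u y)"
      by (rule rdeg_le_mono) (use k in simp)
    then show ?thesis
      using u0[OF y] by (simp add: near_one_divide_iff)
  qed
  have main: "near_one (Suc i) (x / y)"
    if "near_one (Suc i) (((\<phi> * one_plus_monom e k) \<circ>\<^sub>R x) / ((\<phi> * one_plus_monom e k) \<circ>\<^sub>R y))" for i
    using that
  proof (induction i)
    case 0
    have "near_one (Suc 0) (u x / u y)"
      using u[OF x] u[OF y] by (simp add: near_one_divide)
    from near_one_divide[OF 0 this] have "near_one (Suc 0) ((\<phi> \<circ>\<^sub>R x) / (\<phi> \<circ>\<^sub>R y))"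
      using x y u0[OF x] u0[OF y] by (simp add: comp_mult flip: u_def)
    then show ?case
      using \<phi> x y by (simp add: separating_def)
  next
    case (Suc i)
    have "near_one (Suc i) (x / y)"
      using Suc.IH near_one_mono[OF Suc.prems] by simp
    then have "near_one (Suc (Suc i)) (u x / u y)"
      by (rule correction) simp
    from near_one_divide[OF Suc.prems this] have "near_one (Suc (Suc i)) ((\<phi> \<circ>\<^sub>R x) / (\<phi> \<circ>\<^sub>R y))"
      using x y u0[OF x] u0[OF y] by (simp add: comp_mult flip: u_def)
    then show ?case
      using \<phi> x y by (simp add: separating_def)
  qed
  assume "near_one j (((\<phi> * one_plus_monom e k) \<circ>\<^sub>R x) / ((\<phi> * one_plus_monom e k) \<circ>\<^sub>R y))"
  then show "near_one j (x / y)"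
    using main[of "j - 1"] j by simp
qed

definition linearisable :: "'a \<Rightarrow> bool" where
  "linearisable \<gamma> \<longleftrightarrow> \<gamma> \<noteq> 0 \<and> (\<forall>k\<ge>1. \<exists>\<phi>. approx_linear \<gamma> k \<phi> \<and> separating \<phi>)"

text \<open>
  Words with the same exponents have the same image under an exact linearisation. With
  approximate linearisations of order \<open>k\<close>, these images agree to order \<open>k\<close>, hence so do the words,
  and \<open>k\<close> is arbitrary.
\<close>

lemma word_eq_iff_of_linearisable:
  assumes "linearisable \<gamma>"
  shows "wd w = wd w' \<longleftrightarrow> dg w = dg w' \<and> \<gamma> ^ tw w = \<gamma> ^ tw w'"
proof
  assume "wd w = wd w'"
  then show "dg w = dg w' \<and> \<gamma> ^ tw w = \<gamma> ^ tw w'"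
    using assms coincidence_imp_same_exponents[of \<gamma> 1] by (metis linearisable_def order_refl)
next
  assume exps: "dg w = dg w' \<and> \<gamma> ^ tw w = \<gamma> ^ tw w'"
  have "wd w / wd w' = 1"
  proof (rule near_one_all_imp_eq_1)
    fix k :: nat
    assume k: "k \<ge> 1"
    with assms obtain \<phi> where \<phi>: "approx_linear \<gamma> k \<phi>" "separating \<phi>" and \<gamma>: "\<gamma> \<noteq> 0"
      by (auto simp: linearisable_def)
    have \<phi>0: "\<phi> \<noteq> 0"
      using \<phi> by (simp add: approx_linear_def)
    have "(\<phi> \<circ>\<^sub>R wd w) / (\<phi> \<circ>\<^sub>R wd w') = err \<gamma> \<phi> w / err \<gamma> \<phi> w'"
      using \<gamma> \<phi>0 exps by (simp add: comp_wd_eq[OF \<gamma> \<phi>0])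
    moreover have "near_one k (err \<gamma> \<phi> w / err \<gamma> \<phi> w')"
      using near_one_err[OF \<gamma> \<phi>(1)] k by (simp add: near_one_divide)
    ultimately show "near_one k (wd w / wd w')"
      using \<phi>(2) k rdeg_wd_pos by (simp add: separating_def)
  qed
  then show "wd w = wd w'"
    by simp
qed

lemma err_mult_one_plus_monom:
  "err \<gamma> (\<phi> * q) [l] = err \<gamma> \<phi> [l] / q ^ dg [l] * (q \<circ>\<^sub>R wd [l])"
  by (simp add: err_def comp_mult rdeg_wd_pos power_mult_distrib)

text \<open>
  The constant \<open>e\<close> is chosen for \<open>F\<close> alone, by taking an approximate \<open>m\<close>-th root of its error. The
  relation then transfers the gain to \<open>G\<close>: by \<open>err_append\<close>, the error of a word is, up to terms of
  higher order, a power of the error of its last letter. So the error of \<open>u \<circ> F\<close>, and with it that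
  of \<open>v \<circ> G\<close>, has order \<open>k + 1\<close>, and the exponent \<open>dg v\<close> can be removed because it is invertible.
\<close>

lemma improve_linearisation:
  assumes \<gamma>: "\<gamma> \<noteq> 0" and k: "k \<ge> 1"
    and rel: "wd (u @ [Letter_F]) = wd (v @ [Letter_G])"
    and \<phi>: "approx_linear \<gamma> k \<phi>"
  obtains e where "approx_linear \<gamma> (Suc k) (\<phi> * one_plus_monom e k)"
proof -
  have \<phi>0: "\<phi> \<noteq> 0"
    using \<phi> by (simp add: approx_linear_def)
  obtain e where e: "near_one (Suc k) (err \<gamma> \<phi> [Letter_F] / one_plus_monom e k ^ m)"
    using \<phi> near_one_root_approx[OF _ k m_unit] unfolding approx_linear_def by metis
  define q \<psi> where "q = one_plus_monom e k" and "\<psi> = \<phi> * q"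
  have q: "near_one k q"
    by (simp add: q_def near_one_one_plus_monom)
  have \<psi>0: "\<psi> \<noteq> 0"
    using \<phi>0 near_one_nonzero[OF q k] by (simp add: \<psi>_def)
  have F: "near_one (Suc k) (err \<gamma> \<psi> [Letter_F])"
    unfolding \<psi>_def err_mult_one_plus_monom
    using e near_one_comp_letter[OF q k, of Letter_F]
    by (intro near_one_mult) (simp_all add: q_def)
  have "near_one k (err \<gamma> \<psi> [Letter_G])"
    unfolding \<psi>_def err_mult_one_plus_monom
    using \<phi> q k near_one_comp_wd[OF q, of "[Letter_G]"]
    by (intro near_one_mult near_one_divide near_one_power) (simp_all add: approx_linear_def)
  moreover from this have \<psi>: "approx_linear \<gamma> k \<psi>"
    using F \<psi>0 by (auto simp: approx_linear_def intro: near_one_mono)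
  moreover have "near_one (Suc k) (err \<gamma> \<psi> [Letter_G] ^ dg v)"
  proof -
    have tail: "near_one (Suc k) (err \<gamma> \<psi> w \<circ>\<^sub>R wd [l])" for w l
      by (rule near_one_comp_letter[OF near_one_err[OF \<gamma> \<psi>] k])
    have "near_one (Suc k) (err \<gamma> \<psi> (u @ [Letter_F]))"
      by (subst err_append[OF \<gamma> \<psi>0]) (intro near_one_mult near_one_power F tail)
    also have "err \<gamma> \<psi> (u @ [Letter_F]) = err \<gamma> \<psi> (v @ [Letter_G])"
      by (rule coincidence_imp_same_exponents(3)[OF \<gamma> \<psi> k rel])
    also have "\<dots> = err \<gamma> \<psi> [Letter_G] ^ dg v * (err \<gamma> \<psi> v \<circ>\<^sub>R wd [Letter_G])"
      by (rule err_append[OF \<gamma> \<psi>0])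
    finally have "near_one (Suc k) (err \<gamma> \<psi> [Letter_G] ^ dg v * (err \<gamma> \<psi> v \<circ>\<^sub>R wd [Letter_G]) /
        (err \<gamma> \<psi> v \<circ>\<^sub>R wd [Letter_G]))"
      using tail by (rule near_one_divide) simp
    then show ?thesis
      using near_one_nonzero[OF tail] by simp
  qed
  ultimately have "near_one (Suc k) (err \<gamma> \<psi> [Letter_G])"
    using near_one_power_cancel[OF _ k of_nat_dg] by blast
  with F \<psi>0 have "approx_linear \<gamma> (Suc k) \<psi>"
    by (simp add: approx_linear_def)
  then show ?thesis
    using that unfolding \<psi>_def q_def by blast
qed

lemma coincidence_imp_linearisable:
  assumes rel: "wd (u @ [Letter_F]) = wd (v @ [Letter_G])"
    and \<gamma>: "\<gamma> \<noteq> 0" and start: "approx_linear \<gamma> 1 \<phi>" "separating \<phi>"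
  shows "linearisable \<gamma>"
proof -
  have "\<exists>\<psi>. approx_linear \<gamma> (Suc k) \<psi> \<and> separating \<psi>" for k
  proof (induction k)
    case 0
    then show ?case
      using start by auto
  next
    case (Suc k)
    then obtain \<psi> where \<psi>: "approx_linear \<gamma> (Suc k) \<psi>" "separating \<psi>"
      by blast
    obtain e where "approx_linear \<gamma> (Suc (Suc k)) (\<psi> * one_plus_monom e (Suc k))"
      using improve_linearisation[OF \<gamma> _ rel \<psi>(1)] by auto
    then show ?case
      using separating_mult_one_plus_monom[OF \<psi>(2), of "Suc k" e] by auto
  qed
  then have "\<exists>\<psi>. approx_linear \<gamma> k \<psi> \<and> separating \<psi>" if "k \<ge> 1" for k
    using that by (cases k) auto
  then show ?thesis
    using \<gamma> by (simp add: linearisable_def)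
qed

text \<open>
  Only the leading coefficient of \<open>F\<close> has to be normalised, which the scaling \<open>c X\<close> achieves if
  \<open>c\<^sup>m\<^sup>-\<^sup>1\<close> is that coefficient.
\<close>

lemma first_linearisation:
  assumes roots: "\<And>a. \<exists>c::'a. c ^ (m - 1) = a"
  obtains \<gamma> \<phi> where "\<gamma> \<noteq> 0" "approx_linear \<gamma> 1 \<phi>" "separating \<phi>"
proof -
  obtain a where a: "a \<noteq> 0" "near_one 1 (F / (ratfun_const a * ratfun_X ^ m))"
    using leading_term_exists[OF rdeg_F] m_gt_1 by auto
  obtain b where b: "b \<noteq> 0" "near_one 1 (G / (ratfun_const b * ratfun_X ^ n))"
    using leading_term_exists[OF rdeg_G] n_gt_1 by auto
  obtain c where c: "c ^ (m - 1) = a"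
    using roots by blast
  have c0: "c \<noteq> 0"
    using c a m_gt_1 by (auto simp: power_0_left)
  have cm: "c ^ m = c * a"
    using c m_gt_1 by (metis power_eq_if not_one_less_zero)
  define \<gamma> where "\<gamma> = c * b / c ^ n"
  define \<phi> where "\<phi> = ratfun_const c * ratfun_X"
  have \<phi>_comp: "\<phi> \<circ>\<^sub>R x = ratfun_const c * x" if "rdeg x > 0" for x
    using that by (simp add: \<phi>_def comp_mult comp_const)
  have "err \<gamma> \<phi> [Letter_F] = F / (ratfun_const a * ratfun_X ^ m)"
    using m_gt_1 c0 rdeg_F
    by (simp add: err_def wd_F \<phi>_comp)
      (simp add: \<phi>_def power_mult_distrib cm flip: ratfun_const_power)
  moreover have "err \<gamma> \<phi> [Letter_G] = G / (ratfun_const b * ratfun_X ^ n)"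
  proof -
    have "ratfun_const \<gamma> * \<phi> ^ n = ratfun_const (\<gamma> * c ^ n) * ratfun_X ^ n"
      by (simp add: \<phi>_def power_mult_distrib ratfun_const_power)
    also have "\<gamma> * c ^ n = c * b"
      using c0 by (simp add: \<gamma>_def)
    finally show ?thesis
      using c0 n_gt_1 rdeg_G by (simp add: err_def wd_G \<phi>_comp)
  qed
  moreover have "\<gamma> \<noteq> 0" "\<phi> \<noteq> 0" "separating \<phi>"
    using b c0 separating_linear by (simp_all add: \<gamma>_def \<phi>_def)
  ultimately show ?thesis
    using a b that[of \<gamma> \<phi>] by (simp add: approx_linear_def)
qed


end

section \<open>Isomorphisms matching the generators\<close>

text \<open>
  An isomorphism that matches generators must send each word to the same word in the new letters.
  It is therefore well defined and injective exactly when the two pairs obey the same relations.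
\<close>

lemma generator_iso_exists_iff:
  assumes "ratfun_pair F G m n" "ratfun_pair F' G' m' n'"
  shows "(\<exists>\<phi>. comp_semigroup_iso \<phi> (comp_semigroup F G) (comp_semigroup F' G') \<and> \<phi> F = F' \<and> \<phi> G = G')
     \<longleftrightarrow> (\<forall>w w'. w \<noteq> [] \<longrightarrow> w' \<noteq> [] \<longrightarrow>
           (word_comp F G w = word_comp F G w' \<longleftrightarrow> word_comp F' G' w = word_comp F' G' w'))"
    (is "?iso \<longleftrightarrow> ?same")
proof
  interpret P: ratfun_pair F G m n by fact
  interpret Q: ratfun_pair F' G' m' n' by fact
  let ?wd = "word_comp F G" and ?wd' = "word_comp F' G'"
  let ?S = "comp_semigroup F G" and ?T = "comp_semigroup F' G'"
  have in_S: "?wd w \<in> ?S" if "w \<noteq> []" for w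
    using that by (auto simp: comp_semigroup_def)
  {
    assume ?iso
    then obtain \<phi> where \<phi>: "bij_betw \<phi> ?S ?T" "\<phi> F = F'" "\<phi> G = G'"
        and hom: "\<And>a b. a \<in> ?S \<Longrightarrow> b \<in> ?S \<Longrightarrow> \<phi> (a \<circ>\<^sub>R b) = \<phi> a \<circ>\<^sub>R \<phi> b"
      by (auto simp: comp_semigroup_iso_def)
    have letter: "\<phi> (?wd [l]) = ?wd' [l]" for l
      using \<phi> by (cases l) (simp_all add: P.wd_F P.wd_G Q.wd_F Q.wd_G)
    have word: "\<phi> (?wd w) = ?wd' w" if "w \<noteq> []" for w
      using that
    proof (induction w rule: list_nonempty_induct)
      case (cons l w)
      have "\<phi> (?wd ([l] @ w)) = \<phi> (?wd [l]) \<circ>\<^sub>R \<phi> (?wd w)"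
        unfolding P.wd_append by (intro hom in_S) (use cons in simp_all)
      then show ?case
        using cons Q.wd_append[of "[l]" w] by (simp add: letter)
    qed (rule letter)
    show ?same
    proof (intro allI impI)
      fix w w' :: "letter list"
      assume "w \<noteq> []" "w' \<noteq> []"
      then show "?wd w = ?wd w' \<longleftrightarrow> ?wd' w = ?wd' w'"
        using bij_betw_imp_inj_on[OF \<phi>(1)] in_S word by (metis inj_on_eq_iff)
    qed
  }
  {
    assume same: ?same
    define \<phi> where "\<phi> x = ?wd' (SOME w. w \<noteq> [] \<and> ?wd w = x)" for x
    have word: "\<phi> (?wd w) = ?wd' w" if "w \<noteq> []" for w
    proof -
      define v where "v = (SOME v. v \<noteq> [] \<and> ?wd v = ?wd w)"
      have "v \<noteq> [] \<and> ?wd v = ?wd w"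
        unfolding v_def by (rule someI[of _ w]) (use that in simp)
      then have "?wd' v = ?wd' w"
        using same that by blast
      then show ?thesis
        by (simp add: \<phi>_def v_def)
    qed
    have "bij_betw \<phi> ?S ?T"
    proof (rule bij_betw_imageI)
      show "inj_on \<phi> ?S"
        using word same by (auto simp: inj_on_def comp_semigroup_def)
      show "\<phi> ` ?S = ?T"
        using word by (force simp: comp_semigroup_def image_image)
    qed
    moreover have "\<phi> (a \<circ>\<^sub>R b) = \<phi> a \<circ>\<^sub>R \<phi> b" if ab: "a \<in> ?S" "b \<in> ?S" for a b
    proof -
      obtain u where "u \<noteq> []" "a = ?wd u"
        using ab(1) by (auto simp: comp_semigroup_def)
      moreover obtain v where "v \<noteq> []" "b = ?wd v"
        using ab(2) by (auto simp: comp_semigroup_def)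
      ultimately show ?thesis
        by (simp add: word Q.wd_append flip: P.wd_append)
    qed
    moreover have "\<phi> F = F'" "\<phi> G = G'"
      using word[of "[Letter_F]"] word[of "[Letter_G]"]
      by (simp_all add: P.wd_F P.wd_G Q.wd_F Q.wd_G)
    ultimately show ?iso
      by (auto simp: comp_semigroup_iso_def)
  }
qed

section \<open>Roots of unity and the monomial model\<close>

lemma is_root_of_unity_of_power_eq:
  fixes c :: "'a::field"
  assumes "c \<noteq> 0" "c ^ a = c ^ b" "a \<noteq> b"
  shows "is_root_of_unity c"
  using assms(2,3)
proof (induction a b rule: linorder_wlog)
  case (le a b)
  then have "c ^ b = c ^ a * c ^ (b - a)"
    using power_add[of c a "b - a"] by simp
  then have "c ^ (b - a) = 1"
    using le assms(1) by simp
  then show ?case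
    using le by (auto simp: is_root_of_unity_def intro!: exI[of _ "b - a"])
qed metis

text \<open>
  The powers of \<open>m\<close> are eventually periodic modulo the order of \<open>c\<close>, by the pigeonhole principle.
\<close>

lemma root_of_unity_power_period:
  fixes c :: "'a::field"
  assumes "is_root_of_unity c"
  obtains i j where "j > 0" "\<And>r t a. r \<ge> i \<Longrightarrow> c ^ (m ^ (r + j * t) * a) = c ^ (m ^ r * a)"
proof -
  obtain k where k: "k > 0" "c ^ k = 1"
    using assms by (auto simp: is_root_of_unity_def)
  have c_mod: "c ^ a = c ^ (a mod k)" for a
  proof -
    have "c ^ a = c ^ (k * (a div k) + a mod k)"
      by simp
    also have "\<dots> = c ^ (a mod k)"
      unfolding power_add power_mult k by simp
    finally show ?thesis .
  qed
  have "\<not> inj (\<lambda>r. m ^ r mod k)"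
  proof
    assume "inj (\<lambda>r. m ^ r mod k)"
    moreover have "range (\<lambda>r. m ^ r mod k) \<subseteq> {..<k}"
      using k by auto
    ultimately have "finite (UNIV :: nat set)"
      using finite_lessThan inj_on_finite by blast
    then show False
      by simp
  qed
  then obtain i i' where "m ^ i mod k = m ^ i' mod k" "i < i'"
    unfolding inj_def by (metis linorder_neqE_nat)
  then obtain j where j: "j > 0" "m ^ (i + j) mod k = m ^ i mod k"
    by (metis less_imp_add_positive)
  have step: "m ^ (r + j) mod k = m ^ r mod k" if "r \<ge> i" for r
  proof -
    define s where "s = r - i"
    have "r = i + s"
      using that by (simp add: s_def)
    then have "m ^ (r + j) = m ^ (i + j) * m ^ s" "m ^ r = m ^ i * m ^ s"
      by (simp_all add: power_add)
    then show ?thesis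
      using mod_mult_cong[OF j(2) refl] by metis
  qed
  have period: "m ^ (r + j * t) mod k = m ^ r mod k" if "r \<ge> i" for r t
  proof (induction t)
    case (Suc t)
    have "m ^ (r + j * Suc t) mod k = m ^ (r + j * t + j) mod k"
      by (simp add: add_ac)
    also have "\<dots> = m ^ (r + j * t) mod k"
      using that by (intro step) simp
    finally show ?case
      using Suc by simp
  qed simp
  have "c ^ (m ^ (r + j * t) * a) = c ^ (m ^ r * a)" if "r \<ge> i" for r t a
  proof -
    have "c ^ (m ^ (r + j * t) * a) = c ^ ((m ^ (r + j * t) * a) mod k)"
      by (rule c_mod)
    also have "(m ^ (r + j * t) * a) mod k = (m ^ r * a) mod k"
      by (rule mod_mult_cong[OF period[OF that] refl])
    also have "c ^ \<dots> = c ^ (m ^ r * a)"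
      by (rule c_mod[symmetric])
    finally show ?thesis .
  qed
  with j(1) show ?thesis
    using that by blast
qed

text \<open>For the two monomials, \<open>\<phi> = X\<close> is an exact linearisation.\<close>

lemma monomial_pair:
  fixes \<gamma> :: "'a::field"
  assumes "m > 1" "n > 1" "of_nat m \<noteq> (0::'a)" "of_nat n \<noteq> (0::'a)" "\<gamma> \<noteq> 0"
  defines "F \<equiv> to_fract (monom 1 m)" and "G \<equiv> to_fract (monom \<gamma> n)"
  shows "ratfun_pair F G m n" "ratfun_pair.linearisable F G m n \<gamma>"
proof -
  show *: "ratfun_pair F G m n"
    using assms by unfold_locales (simp_all add: F_def G_def to_fract_def rdeg_Fract degree_monom_eq)
  interpret ratfun_pair F G m n by (rule *)
  have mon: "to_fract (monom c k) = ratfun_const c * ratfun_X ^ k" for c :: 'a and k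
  proof (induction k)
    case (Suc k)
    have "monom c (Suc k) = [:0, 1:] * monom c k"
      by (simp add: monom_Suc)
    then show ?case
      using Suc by (simp only: to_fract_mult) (simp add: ratfun_X_def)
  qed (simp add: ratfun_const_def monom_0)
  have err_1: "err \<gamma> ratfun_X [l] = 1" for l
  proof -
    have "F = ratfun_X ^ m" "G = ratfun_const \<gamma> * ratfun_X ^ n"
      by (simp_all add: F_def G_def mon)
    then have "wd [l] = ratfun_const (\<gamma> ^ tw [l]) * ratfun_X ^ dg [l]"
      by (cases l) (use wd_F wd_G in simp_all)
    then show ?thesis
      using assms(5) by (simp add: err_def)
  qed
  have "approx_linear \<gamma> k ratfun_X" for k
    by (simp add: approx_linear_def err_1)
  moreover have "separating ratfun_X"
    by (simp add: separating_def)
  ultimately show "linearisable \<gamma>"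
    using assms(5) by (auto simp: linearisable_def)
qed

section \<open>Relations in the semigroup\<close>

context ratfun_pair
begin

lemma not_free_imp_linearisable:
  assumes "\<not> comp_semigroup_free F G" and roots: "\<And>a. \<exists>c::'a. c ^ (m - 1) = a"
  obtains \<gamma> where "is_root_of_unity \<gamma>" "linearisable \<gamma>"
proof -
  obtain w w' where "wd w = wd w'" "w \<noteq> w'"
    using assms(1) by (auto simp: comp_semigroup_free_def inj_on_def)
  then obtain u v where rel: "wd (u @ [Letter_F]) = wd (v @ [Letter_G])"
    using coincidence_different_last_letters by blast
  obtain \<gamma> \<phi> where \<gamma>: "\<gamma> \<noteq> 0" "approx_linear \<gamma> 1 \<phi>" "separating \<phi>"
    using first_linearisation[OF roots] .
  have "linearisable \<gamma>"
    using coincidence_imp_linearisable[OF rel \<gamma>] .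
  moreover have "is_root_of_unity \<gamma>"
    using coincidence_imp_same_exponents(1,2)[OF \<gamma>(1,2) order_refl rel]
      word_twist_neq[OF m_gt_1 n_gt_1] is_root_of_unity_of_power_eq[OF \<gamma>(1)] by metis
  ultimately show ?thesis
    using that by blast
qed

lemma not_freeI:
  assumes "wd w = wd w'" "w \<noteq> []" "w' \<noteq> []" "w \<noteq> w'"
  shows "\<not> comp_semigroup_free F G"
  using assms by (auto simp: comp_semigroup_free_def inj_on_def)

lemma commute_iff_words:
  "ratfun_commute (ratfun_iter F r \<circ>\<^sub>R ratfun_iter G s) (ratfun_iter F j) \<longleftrightarrow>
     wd (replicate r Letter_F @ replicate s Letter_G @ replicate j Letter_F) =
     wd (replicate j Letter_F @ replicate r Letter_F @ replicate s Letter_G)"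
  by (simp add: ratfun_commute_def wd_append comp_assoc rdeg_wd_pos
      flip: wd_replicate_F wd_replicate_G)

lemma ratfun_iter_G_1: "ratfun_iter G 1 = G"
  by (simp add: ratfun_iter_def)

lemma commute_imp_not_free:
  assumes "ratfun_commute (ratfun_iter F r \<circ>\<^sub>R G) (ratfun_iter F j)" "j > 0"
  shows "\<not> comp_semigroup_free F G"
proof (rule not_freeI)
  show "wd (replicate r Letter_F @ replicate 1 Letter_G @ replicate j Letter_F) =
        wd (replicate j Letter_F @ replicate r Letter_F @ replicate 1 Letter_G)"
    using assms(1) commute_iff_words[of r 1 j] unfolding ratfun_iter_G_1 by simp
  have "last (replicate r Letter_F @ replicate 1 Letter_G @ replicate j Letter_F) = Letter_F"
    using assms(2) by simp
  then show "replicate r Letter_F @ replicate 1 Letter_G @ replicate j Letter_F \<noteq>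
        replicate j Letter_F @ replicate r Letter_F @ replicate 1 Letter_G"
    by (metis append_assoc last_snoc letter.distinct(1) One_nat_def replicate_0 replicate_Suc)
qed simp_all

text \<open>
  Moving \<open>F\<^bsup>\<langle>j\<rangle>\<^esup>\<close> from the right end of the word to the left multiplies the twist by \<open>m\<^sup>j\<close>.
\<close>

lemma linearisable_commute_iff:
  assumes "linearisable \<gamma>"
  shows "ratfun_commute (ratfun_iter F r \<circ>\<^sub>R ratfun_iter G s) (ratfun_iter F j) \<longleftrightarrow>
     \<gamma> ^ (m ^ r * tw (replicate s Letter_G)) = \<gamma> ^ (m ^ (r + j) * tw (replicate s Letter_G))"
  unfolding commute_iff_words word_eq_iff_of_linearisable[OF assms]
  by (simp add: word_deg_append word_twist_append word_deg_replicate_F word_twist_replicate_F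
      power_add mult_ac)

lemma linearisable_imp_iterates_commute:
  assumes \<gamma>: "is_root_of_unity \<gamma>" "linearisable \<gamma>"
  shows "\<exists>r>0. ratfun_commute (ratfun_iter F r \<circ>\<^sub>R G) (ratfun_iter F r)"
    and "\<exists>i j. j > 0 \<and>
           (\<forall>r\<ge>i. \<forall>s\<ge>1. ratfun_commute (ratfun_iter F r \<circ>\<^sub>R ratfun_iter G s) (ratfun_iter F j))"
proof -
  obtain i j where j: "j > 0"
      and period: "\<And>r t a. r \<ge> i \<Longrightarrow> \<gamma> ^ (m ^ (r + j * t) * a) = \<gamma> ^ (m ^ r * a)"
    by (rule root_of_unity_power_period[OF \<gamma>(1), of m]) blast
  have commute: "ratfun_commute (ratfun_iter F r \<circ>\<^sub>R ratfun_iter G s) (ratfun_iter F (j * t))"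
    if "r \<ge> i" for r s t
    unfolding linearisable_commute_iff[OF \<gamma>(2)] by (rule period[OF that, symmetric])
  (* a multiple of the period j beyond the preperiod i serves as both exponents *)
  have "i \<le> j * Suc i"
    using mult_le_mono1[of 1 j "Suc i"] j by simp
  then have "ratfun_commute (ratfun_iter F (j * Suc i) \<circ>\<^sub>R G) (ratfun_iter F (j * Suc i))"
    using commute[of "j * Suc i" 1 "Suc i"] unfolding ratfun_iter_G_1 by blast
  moreover have "j * Suc i > 0"
    using j by simp
  ultimately show "\<exists>r>0. ratfun_commute (ratfun_iter F r \<circ>\<^sub>R G) (ratfun_iter F r)"
    by blast
  have "ratfun_commute (ratfun_iter F r \<circ>\<^sub>R ratfun_iter G s) (ratfun_iter F j)" if "r \<ge> i" for r s
    using commute[OF that, of s 1] by (simp only: mult_1_right)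
  then show "\<exists>i j. j > 0 \<and>
           (\<forall>r\<ge>i. \<forall>s\<ge>1. ratfun_commute (ratfun_iter F r \<circ>\<^sub>R ratfun_iter G s) (ratfun_iter F j))"
    using j by (intro exI[of _ i] exI[of _ j]) simp
qed

lemma monomial_model_iff:
  assumes "linearisable \<gamma>"
  shows "word_comp F G w = word_comp F G w' \<longleftrightarrow>
    word_comp (to_fract (monom 1 m)) (to_fract (monom \<gamma> n)) w =
    word_comp (to_fract (monom 1 m)) (to_fract (monom \<gamma> n)) w'"
proof -
  have "\<gamma> \<noteq> 0"
    using assms by (simp add: linearisable_def)
  note model = monomial_pair[OF m_gt_1 n_gt_1 m_unit n_unit this]
  show ?thesis
    unfolding word_eq_iff_of_linearisable[OF assms]
      ratfun_pair.word_eq_iff_of_linearisable[OF model] ..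
qed

end

theorem theorem1p3:
  fixes A B C D :: "'a::alg_closed_field poly"
    and F G :: "'a ratfun"
    and m n :: nat
  assumes "m > 1" and "n > 1"
    and "\<not> CHAR('a) dvd m" and "\<not> CHAR('a) dvd n"
    and "A \<noteq> 0" and "B \<noteq> 0" and "C \<noteq> 0" and "D \<noteq> 0"
    and "int (degree A) - int (degree B) = int m"
    and "int (degree C) - int (degree D) = int n"
    and "F = Fract A B" and "G = Fract C D"
  shows
    "(\<not> comp_semigroup_free F G \<longleftrightarrow>
        (\<exists>\<gamma>::'a. \<gamma> \<noteq> 0 \<and> is_root_of_unity \<gamma> \<and>
          (\<exists>\<phi>. comp_semigroup_iso \<phi>
                  (comp_semigroup F G)
                  (comp_semigroup (to_fract (monom 1 m)) (to_fract (monom \<gamma> n))) \<and>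
                \<phi> F = to_fract (monom 1 m) \<and> \<phi> G = to_fract (monom \<gamma> n)))) \<and>
     (\<not> comp_semigroup_free F G \<longleftrightarrow>
        (\<exists>r::nat. r > 0 \<and> ratfun_commute (ratfun_iter F r \<circ>\<^sub>R G) (ratfun_iter F r))) \<and>
     (\<not> comp_semigroup_free F G \<longleftrightarrow>
        (\<exists>i j::nat. j > 0 \<and>
          (\<forall>r\<ge>i. \<forall>s\<ge>1. ratfun_commute (ratfun_iter F r \<circ>\<^sub>R ratfun_iter G s) (ratfun_iter F j))))"
proof -
  interpret ratfun_pair F G m n
    using assms by unfold_locales (simp_all add: of_nat_eq_0_iff_char_dvd rdeg_Fract)
  have roots: "\<exists>c::'a. c ^ (m - 1) = a" for a
    using nth_root_exists[of "m - 1" a] assms(1) by auto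
  let ?F = "to_fract (monom (1::'a) m)" and ?G = "\<lambda>\<gamma>::'a. to_fract (monom \<gamma> n)"
  have iso_iff: "(\<exists>\<phi>. comp_semigroup_iso \<phi> (comp_semigroup F G) (comp_semigroup ?F (?G \<gamma>)) \<and>
            \<phi> F = ?F \<and> \<phi> G = ?G \<gamma>) \<longleftrightarrow>
          (\<forall>w w'. w \<noteq> [] \<longrightarrow> w' \<noteq> [] \<longrightarrow>
             (wd w = wd w' \<longleftrightarrow> word_comp ?F (?G \<gamma>) w = word_comp ?F (?G \<gamma>) w'))"
    if "\<gamma> \<noteq> 0" for \<gamma>
    by (rule generator_iso_exists_iff[OF ratfun_pair_axioms
          monomial_pair(1)[OF m_gt_1 n_gt_1 m_unit n_unit that]])
  (* the monomials satisfy the commutation relation, so the isomorphism carries one back to F and G *)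
  have model_not_free: "\<not> comp_semigroup_free ?F (?G \<gamma>)" if "\<gamma> \<noteq> 0" "is_root_of_unity \<gamma>" for \<gamma>
  proof -
    interpret M: ratfun_pair ?F "?G \<gamma>" m n
      by (rule monomial_pair(1)[OF m_gt_1 n_gt_1 m_unit n_unit that(1)])
    have "M.linearisable \<gamma>"
      by (rule monomial_pair(2)[OF m_gt_1 n_gt_1 m_unit n_unit that(1)])
    then show ?thesis
      using M.linearisable_imp_iterates_commute(1)[OF that(2)] M.commute_imp_not_free by blast
  qed
  show ?thesis (is "(?one \<longleftrightarrow> ?two) \<and> (_ \<longleftrightarrow> ?three) \<and> (_ \<longleftrightarrow> ?four)")
  proof (intro conjI iffI)
    assume ?one
    then obtain \<gamma> where \<gamma>: "is_root_of_unity \<gamma>" "linearisable \<gamma>"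
      using not_free_imp_linearisable[OF _ roots] by blast
    then show ?two
      using iso_iff monomial_model_iff[OF \<gamma>(2)] by (intro exI[of _ \<gamma>]) (auto simp: linearisable_def)
    show ?three ?four
      using linearisable_imp_iterates_commute[OF \<gamma>] by blast+
  next
    assume ?two
    then obtain \<gamma> where \<gamma>: "\<gamma> \<noteq> 0" "is_root_of_unity \<gamma>"
        and same: "\<And>w w'. w \<noteq> [] \<Longrightarrow> w' \<noteq> [] \<Longrightarrow>
             wd w = wd w' \<longleftrightarrow> word_comp ?F (?G \<gamma>) w = word_comp ?F (?G \<gamma>) w'"
      using iso_iff by blast
    show ?one
      using model_not_free[OF \<gamma>] same by (auto simp: comp_semigroup_free_def inj_on_def)
  next
    assume ?three
    then show ?one
      using commute_imp_not_free by blast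
  next
    assume ?four
    then obtain i j where "j > 0" and "ratfun_commute (ratfun_iter F i \<circ>\<^sub>R ratfun_iter G 1) (ratfun_iter F j)"
      by blast
    then show ?one
      using commute_imp_not_free unfolding ratfun_iter_G_1 by blast
  qed
qed

end
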